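(* Let $M=2$, $K=3$, and let $N\ge 3$ be an even integer. For angles $\theta_1,\dots,\theta_N\in\mathbb{R}$ let $A(\theta_1,\dots,\theta_N)\in\mathbb{R}^{2\times N}$ be the matrix whose $i$-th column is $(\cos\theta_i,\sin\theta_i)^T$. Then each of the following two choices of angles (a) $\theta_i=\frac{2\pi(i-1)}{N} \bmod \pi$, $1\le i\le N$; (b) $\theta_i=\frac{2\pi(i-1)}{N}$, $1\le i\le N$; minimizes the maximum condition number among all submatrices with $K=3$ columns. That is, for $A=A(\theta_1,\dots,\theta_N)$ with the angles from (a) or from (b), and for every matrix $B\in\mathbb{R}^{2\times N}$ all of whose columns have unit $\ell_2$ norm, $$\max_{S\subseteq\{1,\dots,N\},\,|S|=3}\kappa(A_S)\;\le\;\max_{S\subseteq\{1,\dots,N\},\,|S|=3}\kappa(B_S).$$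
   Context: For a matrix $B\in\mathbb{R}^{2\times N}$ and a subset $S\subseteq\{1,\dots,N\}$ with $|S|=3$, $B_S\in\mathbb{R}^{2\times 3}$ denotes the submatrix consisting of the columns of $B$ indexed by $S$. The condition number of a $2\times 3$ matrix $C$ is $\kappa(C)=\sigma_{\max}(C)/\sigma_{\min}(C)$, where $\sigma_{\max}(C)\ge\sigma_{\min}(C)\ge 0$ are its two singular values (the square roots of the two eigenvalues of $CC^T$), with $\kappa(C)=+\infty$ if $\sigma_{\min}(C)=0$. For a real number $x$, $x\bmod\pi$ denotes the representative of $x$ modulo $\pi$ in $[0,\pi)$. *)

theory Defs
  imports
    "Jordan_Normal_Form.Spectral_Radius"
    "Jordan_Normal_Form.DL_Submatrix"
    "HOL-Library.Extended_Real"
    "HOL-Library.Real_Mod"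
begin

definition vec_l2_norm :: "real vec \<Rightarrow> real" where
  "vec_l2_norm v = sqrt (v \<bullet> v)"

(* The angles are numbered from 1 and matrix columns from 0:
   column j of the matrix carries the angle with number j + 1. *)
definition angle_matrix :: "nat \<Rightarrow> (nat \<Rightarrow> real) \<Rightarrow> real mat" where
  "angle_matrix N \<theta> =
     mat 2 N (\<lambda>(r, j). if r = 0 then cos (\<theta> (Suc j)) else sin (\<theta> (Suc j)))"

(* Singular values of a nonempty matrix with at most as many rows as columns are the square
   roots of the eigenvalues of the real symmetric positive semidefinite matrix C C^T.
   Multiplicities are irrelevant for the extreme ones, so the spectrum as a set suffices. *)
definition sigma_max :: "real mat \<Rightarrow> real" where
  "sigma_max C = sqrt (Max (spectrum (C * transpose_mat C)))"

definition sigma_min :: "real mat \<Rightarrow> real" where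
  "sigma_min C = sqrt (Min (spectrum (C * transpose_mat C)))"

definition cond_number :: "real mat \<Rightarrow> ereal" where
  "cond_number C = (if sigma_min C = 0 then \<infinity> else ereal (sigma_max C / sigma_min C))"

definition max_cond_number :: "nat \<Rightarrow> real mat \<Rightarrow> ereal" where
  "max_cond_number K B =
     (MAX S \<in> {S. S \<subseteq> {0..<dim_col B} \<and> card S = K}. cond_number (submatrix B UNIV S))"

end

theory Submission
  imports Defs
begin

text \<open>For unit columns with angles \<open>t\<^sub>j\<close>, the matrix \<open>B\<^sub>S B\<^sub>S\<^sup>T\<close> has the eigenvalues
  \<open>(3 \<plusminus> R) / 2\<close> where \<open>R\<close> is the modulus of the sum of the \<open>z\<^sub>j = cis (2 * t\<^sub>j)\<close> over \<open>S\<close>, so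
  the condition number increases with \<open>R\<close>. Put \<open>N = 2 * m\<close>. Among any \<open>2 * m\<close> points \<open>z\<^sub>j\<close> of the
  unit circle, three lie on a closed arc of length \<open>2 * pi / m\<close>, whence
  \<open>R\<^sup>2 \<ge> 5 + 4 * cos (2 * pi / m)\<close> for some triple. For both choices of angles the \<open>z\<^sub>j\<close> form the
  regular \<open>m\<close>-gon with every vertex doubled; three of them are never equal, and this gives the
  reverse inequality for every triple.\<close>

section \<open>Condition number of a 2-by-3 matrix with unit columns\<close>

lemma det_2_2:
  assumes "A \<in> carrier_mat 2 2"
  shows "det (A :: 'a :: comm_ring_1 mat) = A $$ (0,0) * A $$ (1,1) - A $$ (0,1) * A $$ (1,0)"
proof -
  have "det A = (\<Sum>j<2. A $$ (0,j) * cofactor A 0 j)"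
    using laplace_expansion_row[OF assms, of 0] by simp
  also have "\<dots> = A $$ (0,0) * cofactor A 0 0 + A $$ (0,1) * cofactor A 0 1"
    by (simp add: numeral_2_eq_2)
  also have "cofactor A 0 0 = A $$ (1,1)"
    using assms det_single[of "mat_delete A 0 0"] by (auto simp: cofactor_def mat_delete_def)
  also have "cofactor A 0 1 = - A $$ (1,0)"
    using assms det_single[of "mat_delete A 0 1"] by (auto simp: cofactor_def mat_delete_def)
  finally show ?thesis by simp
qed

text \<open>The characteristic polynomial has discriminant \<open>(trace)^2 - 4 * det\<close>, and
  for a symmetric matrix this is the left side of the last hypothesis. The sign of \<open>R\<close>
  does not matter, as the set of roots is symmetric in it.\<close>

lemma spectrum_symmetric_2_2:
  fixes A :: "real mat"
  assumes A: "A \<in> carrier_mat 2 2" and sym: "A $$ (1,0) = A $$ (0,1)"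
    and t: "A $$ (0,0) + A $$ (1,1) = t"
    and R: "(A $$ (0,0) - A $$ (1,1))\<^sup>2 + (2 * A $$ (0,1))\<^sup>2 = R\<^sup>2"
  shows "spectrum A = {(t - R) / 2, (t + R) / 2}"
proof -
  have "eigenvalue A x \<longleftrightarrow> x = (t - R) / 2 \<or> x = (t + R) / 2" for x
  proof -
    let ?C = "char_matrix A x"
    have C: "?C \<in> carrier_mat 2 2" using A by auto
    have "det ?C = (A $$ (0,0) - x) * (A $$ (1,1) - x) - A $$ (0,1) * A $$ (0,1)"
      unfolding det_2_2[OF C] using A sym by (simp add: char_matrix_def)
    also have "\<dots> = (x - (t - R) / 2) * (x - (t + R) / 2)"
      using R unfolding t[symmetric] by (simp add: field_simps power2_eq_square)
    finally show ?thesis unfolding eigenvalue_det[OF A] by auto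
  qed
  thus ?thesis unfolding spectrum_def set_eq_iff mem_Collect_eq insert_iff empty_iff by blast
qed

text \<open>\<open>submatrix\<close> enumerates its columns through \<open>pick\<close>; this turns
  the entries of the Gram matrix into sums over \<open>S\<close> itself.\<close>

lemma sum_pick:
  assumes "finite S"
  shows "(\<Sum>k<card S. f (pick S k)) = (\<Sum>j\<in>S. f j)"
proof (rule sum.reindex_bij_betw)
  have inj: "inj_on (pick S) {..<card S}"
    by (rule linorder_inj_onI) (auto dest: pick_mono_le less_imp_neq)
  have "pick S ` {..<card S} \<subseteq> S" by (auto intro: pick_in_set_le)
  moreover have "card (pick S ` {..<card S}) = card S" using card_image[OF inj] by simp
  ultimately have "pick S ` {..<card S} = S" using assms by (simp add: card_subset_eq)
  with inj show "bij_betw (pick S) {..<card S} S" by (simp add: bij_betw_def)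
qed

text \<open>Squaring a column, read as a complex number, gives \<open>Re = x^2 - y^2\<close> and
  \<open>Im = 2 * x * y\<close>. Summed over \<open>S\<close>, these are the difference of the
  diagonal entries of \<open>C * C^T\<close> and twice its off-diagonal entry, while the trace is
  3.\<close>

lemma cond_number_unit_columns:
  fixes B :: "real mat"
  assumes B: "B \<in> carrier_mat 2 N" and S: "S \<subseteq> {0..<N}" "card S = 3"
    and unit: "\<And>j. j \<in> S \<Longrightarrow> (B $$ (0,j))\<^sup>2 + (B $$ (1,j))\<^sup>2 = 1"
  defines "R \<equiv> norm (\<Sum>j\<in>S. (Complex (B $$ (0,j)) (B $$ (1,j)))\<^sup>2)"
  shows "cond_number (submatrix B UNIV S) =
    (if R = 3 then \<infinity> else ereal (sqrt ((3 + R) / 2) / sqrt ((3 - R) / 2)))"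
proof -
  let ?C = "submatrix B UNIV S" and ?z = "\<lambda>j. (Complex (B $$ (0,j)) (B $$ (1,j)))\<^sup>2"
  let ?G = "?C * transpose_mat ?C"
  have fin: "finite S" using S finite_subset by blast
  have "{j. j < dim_col B \<and> j \<in> S} = S" using B S by auto
  hence C: "?C \<in> carrier_mat 2 3" using B S by (auto simp: submatrix_def)
  have Cij: "?C $$ (r, k) = B $$ (r, pick S k)" if "r < 2" "k < 3" for r k
    using that C B by (auto simp: submatrix_def pick_UNIV)
  have G: "?G \<in> carrier_mat 2 2" using C by auto
  have Grs: "?G $$ (r, s) = (\<Sum>j\<in>S. B $$ (r,j) * B $$ (s,j))" if "r < 2" "s < 2" for r s
  proof -
    have "?G $$ (r, s) = (\<Sum>k<3. ?C $$ (r,k) * ?C $$ (s,k))"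
      using that C by (auto simp: scalar_prod_def atLeast0LessThan intro!: sum.cong)
    also have "\<dots> = (\<Sum>k<card S. B $$ (r,pick S k) * B $$ (s,pick S k))"
      using that S by (auto simp: Cij)
    also have "\<dots> = (\<Sum>j\<in>S. B $$ (r,j) * B $$ (s,j))" by (rule sum_pick[OF fin])
    finally show ?thesis .
  qed
  have Re: "Re (\<Sum>j\<in>S. ?z j) = ?G $$ (0,0) - ?G $$ (1,1)"
    by (simp add: Grs sum_subtractf power2_eq_square)
  have Im: "Im (\<Sum>j\<in>S. ?z j) = 2 * ?G $$ (0,1)"
    by (simp add: Grs sum_distrib_left power2_eq_square mult_ac)
  have "?G $$ (0,0) + ?G $$ (1,1) = (\<Sum>j\<in>S. (B $$ (0,j))\<^sup>2 + (B $$ (1,j))\<^sup>2)"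
    by (simp add: Grs sum.distrib power2_eq_square)
  also have "\<dots> = 3" using unit S by simp
  finally have tr: "?G $$ (0,0) + ?G $$ (1,1) = 3" .
  have "spectrum ?G = {(3 - R) / 2, (3 + R) / 2}"
  proof (rule spectrum_symmetric_2_2[OF G _ tr])
    show "?G $$ (1,0) = ?G $$ (0,1)" by (simp add: Grs mult.commute)
    show "(?G $$ (0,0) - ?G $$ (1,1))\<^sup>2 + (2 * ?G $$ (0,1))\<^sup>2 = R\<^sup>2"
      unfolding R_def cmod_power2 Re Im ..
  qed
  \<comment> \<open>This decides which of the two eigenvalues is the larger one.\<close>
  moreover have "R \<ge> 0" by (simp add: R_def)
  ultimately have "sigma_max ?C = sqrt ((3 + R) / 2)" "sigma_min ?C = sqrt ((3 - R) / 2)"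
    by (auto simp: sigma_max_def sigma_min_def max_def min_def)
  thus ?thesis by (auto simp: cond_number_def)
qed

section \<open>Sums of three points of the unit circle and the lower bound for some triple\<close>

lemma norm_sum_cis_3:
  "(norm (cis x + cis y + cis w))\<^sup>2 = 3 + 2 * (cos (x - y) + cos (y - w) + cos (x - w))"
proof -
  have expand: "(a + b + c)\<^sup>2 + (a' + b' + c')\<^sup>2 = (a\<^sup>2 + a'\<^sup>2) + (b\<^sup>2 + b'\<^sup>2) + (c\<^sup>2 + c'\<^sup>2)
      + 2 * ((a * b + a' * b') + (b * c + b' * c') + (a * c + a' * c'))"
    for a b c a' b' c' :: real
    by (simp add: power2_eq_square algebra_simps)
  have "(cos x + cos y + cos w)\<^sup>2 + (sin x + sin y + sin w)\<^sup>2 =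
      ((cos x)\<^sup>2 + (sin x)\<^sup>2) + ((cos y)\<^sup>2 + (sin y)\<^sup>2) + ((cos w)\<^sup>2 + (sin w)\<^sup>2)
      + 2 * (cos (x - y) + cos (y - w) + cos (x - w))"
    unfolding cos_diff by (rule expand)
  thus ?thesis by (simp add: cmod_power2)
qed

text \<open>With \<open>s\<close> the half sum and \<open>h\<close> the half difference,
  \<open>cos a + cos b = 2 * cos s * cos h\<close>, and \<open>\<bar>h\<bar> \<le> s\<close> bounds
  this below by \<open>2 * (cos s)^2 = 1 + cos (a + b)\<close>. Equality holds for
  \<open>a = 0\<close>, \<open>b = d\<close>: two points coincide and the third lies at the other
  end of the arc.\<close>

lemma cos_add_cos_add_cos_ge:
  fixes a b d :: real
  assumes "0 \<le> a" "0 \<le> b" "a + b \<le> d" "d \<le> pi"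
  shows "cos a + cos b + cos (a + b) \<ge> 1 + 2 * cos d"
proof -
  let ?s = "(a + b) / 2" and ?h = "(a - b) / 2"
  have "a + b = 2 * ?s" by (simp add: field_simps)
  hence "cos (a + b) = cos (2 * ?s)" by (rule arg_cong)
  also have "\<dots> = 2 * (cos ?s)\<^sup>2 - 1" by (rule cos_double_cos)
  finally have double: "cos (a + b) = 2 * (cos ?s)\<^sup>2 - 1" .
  have "cos ?s \<le> cos \<bar>?h\<bar>" using assms by (intro cos_monotone_0_pi_le) auto
  hence h: "cos ?s \<le> cos ?h" by (simp only: cos_abs_real)
  have s: "cos ?s \<ge> 0" using assms by (intro cos_ge_zero) auto
  have "cos a + cos b = 2 * cos ?s * cos ?h" by (simp add: cos_plus_cos)
  also have "\<dots> \<ge> 2 * (cos ?s)\<^sup>2"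
    using mult_left_mono[OF h s] by (simp add: power2_eq_square)
  also have "2 * (cos ?s)\<^sup>2 = 1 + cos (a + b)"
    using double by simp
  finally have "cos a + cos b \<ge> 1 + cos (a + b)" .
  moreover have "cos d \<le> cos (a + b)" using assms by (intro cos_monotone_0_pi_le) auto
  ultimately show ?thesis by linarith
qed

text \<open>The sum is symmetric in the three points, so they may be sorted; the two gaps between
  neighbours then serve as \<open>a\<close> and \<open>b\<close> of the previous lemma.\<close>

lemma cos_differences_ge:
  fixes x y w d :: real
  assumes "{x, y, w} \<subseteq> {p..p + d}" "d \<le> pi"
  shows "cos (x - y) + cos (y - w) + cos (x - w) \<ge> 1 + 2 * cos d"
proof -
  have sorted: "cos (x - y) + cos (y - w) + cos (x - w) \<ge> 1 + 2 * cos d"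
    if "x \<le> y" "y \<le> w" "p \<le> x" "w \<le> p + d" for x y w
    using cos_add_cos_add_cos_ge[of "y - x" "w - y" d] that assms(2)
    by (simp add: cos_diff mult.commute)
  have sym: "cos (u - v) = cos (v - u)" for u v :: real
    by (simp add: cos_diff mult.commute)
  have b: "p \<le> x" "p \<le> y" "p \<le> w" "x \<le> p + d" "y \<le> p + d" "w \<le> p + d"
    using assms(1) by auto
  consider "x \<le> y" "y \<le> w" | "x \<le> w" "w \<le> y" | "y \<le> x" "x \<le> w"
    | "y \<le> w" "w \<le> x" | "w \<le> x" "x \<le> y" | "w \<le> y" "y \<le> x"
    by linarith
  thus ?thesis
  proof cases
    case 1
    from sorted[OF this b(1,6)] show ?thesis .
  next
    case 2
    from sorted[OF this b(1,5)] sym[of w y] show ?thesis by linarith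
  next
    case 3
    from sorted[OF this b(2,6)] sym[of x y] show ?thesis by linarith
  next
    case 4
    from sorted[OF this b(2,4)] sym[of x y] sym[of x w] show ?thesis by linarith
  next
    case 5
    from sorted[OF this b(3,5)] sym[of w x] sym[of w y] show ?thesis by linarith
  next
    case 6
    from sorted[OF this b(3,4)] sym[of w y] sym[of y x] sym[of w x] show ?thesis by linarith
  qed
qed

text \<open>Rotate so that the first point has angle 0. This point lies on the boundary of two of the
  \<open>m\<close> closed arcs into which the circle is divided, so there are \<open>2 * m + 1\<close> incidences and some
  closed arc contains three of the points.\<close>

lemma exists_large_triple:
  fixes z :: "nat \<Rightarrow> complex"
  assumes m: "m \<ge> 2" and z: "\<And>j. j < 2 * m \<Longrightarrow> norm (z j) = 1"
  shows "\<exists>S\<subseteq>{0..<2 * m}. card S = 3 \<and> (norm (\<Sum>j\<in>S. z j))\<^sup>2 \<ge> 5 + 4 * cos (2 * pi / m)"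
proof -
  define d where "d = 2 * pi / m"
  have d: "0 < d" "d \<le> pi" "d * m = 2 * pi" using m by (auto simp: d_def field_simps)
  have "\<exists>t. 0 \<le> t \<and> t < 2 * pi \<and> z j = z 0 * cis t" if "j < 2 * m" for j
  proof -
    have n: "norm (z j / z 0) = 1" using z m that by (simp add: norm_divide)
    hence "(Re (z j / z 0))\<^sup>2 + (Im (z j / z 0))\<^sup>2 = 1" using cmod_power2[of "z j / z 0"] by simp
    then obtain t where "0 \<le> t" "t < 2 * pi" "Re (z j / z 0) = cos t" "Im (z j / z 0) = sin t"
      by (rule sincos_total_2pi)
    moreover from this have "z j / z 0 = cis t" by (simp add: complex_eq_iff)
    moreover have "z 0 \<noteq> 0" using z[of 0] m by auto
    ultimately show ?thesis by (auto simp: field_simps)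
  qed
  then obtain u where u: "\<And>j. j < 2 * m \<Longrightarrow> 0 \<le> u j \<and> u j < 2 * pi \<and> z j = z 0 * cis (u j)"
    by metis
  \<comment> \<open>Indices 0 and \<open>2 * m\<close> both stand for the first point, once with
    angle 0 and once with angle \<open>2 * pi\<close>.\<close>
  define v where "v i = (if i = 0 then 0 else if i = 2 * m then 2 * pi else u i)" for i
  \<comment> \<open>Arc number \<open>f i\<close> starts at \<open>f i * d\<close>. The floor would
    give \<open>m\<close> at the angle \<open>2 * pi\<close>, which has to count for the last arc
    \<open>m - 1\<close>.\<close>
  define f where "f i = (if i = 2 * m then m - 1 else nat \<lfloor>v i / d\<rfloor>)" for i
  have zv: "z (i mod (2 * m)) = z 0 * cis (v i)" if "i \<le> 2 * m" for i
  proof (cases "i = 0 \<or> i = 2 * m")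
    case True
    thus ?thesis by (auto simp: v_def)
  next
    case False
    thus ?thesis using that u[of i] by (simp add: v_def)
  qed
  have v: "0 \<le> v i \<and> v i < 2 * pi" if "i < 2 * m" for i
    using that u[of i] by (auto simp: v_def)
  have arc: "f i < m \<and> v i \<in> {f i * d..f i * d + d}" if "i \<le> 2 * m" for i
  proof (cases "i = 2 * m")
    case True
    thus ?thesis using m d by (auto simp: v_def f_def of_nat_diff algebra_simps)
  next
    case False
    hence "0 \<le> v i" "v i < d * m" using v[of i] that d by auto
    hence 0: "0 \<le> v i / d" "v i / d < m" using d by (auto simp: field_simps)
    hence fi: "real (f i) = of_int \<lfloor>v i / d\<rfloor>" using False by (simp add: f_def)
    have "real (f i) \<le> v i / d" "v i / d < real (f i) + 1" unfolding fi by linarith+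
    moreover from this 0 have "f i < m" by linarith
    ultimately show ?thesis using d by (auto simp: field_simps)
  qed
  have "f \<in> {..2 * m} \<rightarrow> {..<m}" using arc by blast
  then obtain k where "card {..2 * m} \<le> card (f -` {k} \<inter> {..2 * m}) * card {..<m}"
    using pigeonhole_card[of f "{..2 * m}" "{..<m}"] m by force
  hence "2 * m < card (f -` {k} \<inter> {..2 * m}) * m"
    by (simp only: card_atMost card_lessThan Suc_le_eq)
  hence "3 \<le> card (f -` {k} \<inter> {..2 * m})" unfolding mult_less_cancel2 by simp
  then obtain T where T: "T \<subseteq> f -` {k} \<inter> {..2 * m}" "card T = 3"
    by (metis obtain_subset_with_card_n)
  \<comment> \<open>The first and the last arc differ because \<open>m \<ge> 2\<close>. Hence
    \<open>T\<close> cannot contain both copies of the first point, and its three indices remain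
    distinct modulo \<open>2 * m\<close>.\<close>
  have "f 0 \<noteq> f (2 * m)" using m by (simp add: f_def v_def)
  hence "\<not> (0 \<in> T \<and> 2 * m \<in> T)" using T(1) by auto
  moreover have "i mod (2 * m) = (if i = 2 * m then 0 else i)" if "i \<in> T" for i
    using that T(1) by auto
  ultimately have inj: "inj_on (\<lambda>i. i mod (2 * m)) T"
    unfolding inj_on_def by metis
  let ?S = "(\<lambda>i. i mod (2 * m)) ` T"
  from T(2) obtain a b c where abc: "T = {a, b, c}" "a \<noteq> b" "b \<noteq> c" "a \<noteq> c"
    by (auto simp: card_3_iff)
  have abc': "a \<le> 2 * m" "b \<le> 2 * m" "c \<le> 2 * m" "f a = k" "f b = k" "f c = k"
    using T(1) abc by auto
  have "(\<Sum>j\<in>?S. z j) = (\<Sum>i\<in>T. z (i mod (2 * m)))" by (simp add: sum.reindex[OF inj])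
  also have "\<dots> = z 0 * (cis (v a) + cis (v b) + cis (v c))"
    using abc abc' zv by (simp add: algebra_simps)
  finally have "(norm (\<Sum>j\<in>?S. z j))\<^sup>2 = 3 + 2 * (cos (v a - v b) + cos (v b - v c) + cos (v a - v c))"
    using z[of 0] m by (simp add: norm_mult norm_sum_cis_3)
  moreover have "cos (v a - v b) + cos (v b - v c) + cos (v a - v c) \<ge> 1 + 2 * cos d"
    using arc[of a] arc[of b] arc[of c] abc' d by (intro cos_differences_ge[of _ _ _ "k * d"]) auto
  moreover have "card ?S = 3" using card_image[OF inj] T by simp
  moreover have "?S \<subseteq> {0..<2 * m}" using m by auto
  ultimately show ?thesis unfolding d_def by (intro exI[of _ ?S]) auto
qed

section \<open>Upper bound for the doubled regular polygon\<close>

text \<open>Replacing \<open>r\<close> by \<open>m - r\<close> keeps the cosine, so the angle may be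
  taken at most \<open>pi\<close>, where the cosine decreases.\<close>

lemma cos_root_of_unity_le:
  assumes "0 < r" "r < m"
  shows "cos (2 * pi * real r / m) \<le> cos (2 * pi / m)"
proof -
  have le: "cos (2 * pi * real q / m) \<le> cos (2 * pi / m)" if "0 < q" "2 * q \<le> m" for q
  proof -
    have "2 * real q \<le> m" using that by linarith
    thus ?thesis using that by (intro cos_monotone_0_pi_le) (auto simp: field_simps)
  qed
  have "cos (2 * pi * real r / m) = cos (2 * pi * real (m - r) / m)"
    using assms cos_2pi_minus[of "2 * pi * real (m - r) / m"]
    by (simp add: of_nat_diff field_simps)
  thus ?thesis using le[of r] le[of "m - r"] assms by (cases "2 * r \<le> m") auto
qed

text \<open>Two indices below \<open>2 * m\<close> give the same vertex only if they differ by
  \<open>m\<close>, and at most one pair of a triple does. So at most one of the three cosines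
  exceeds \<open>cos (2 * pi / m)\<close>, and that one is at most 1.\<close>

lemma doubled_polygon_triple_le:
  assumes m: "m \<ge> 2" and S: "S \<subseteq> {0..<2 * m}" "card S = 3"
  shows "(norm (\<Sum>j\<in>S. cis (2 * pi * real j / m)))\<^sup>2 \<le> 5 + 4 * cos (2 * pi / m)"
proof -
  let ?c = "\<lambda>i j. cos (2 * pi * real j / m - 2 * pi * real i / m)"
  have le: "?c i j \<le> cos (2 * pi / m)" if "i < j" "j < 2 * m" "j \<noteq> i + m" for i j
  proof -
    have c: "?c i j = cos (2 * pi * real (j - i) / m)"
      using that by (simp add: of_nat_diff diff_divide_distrib algebra_simps)
    show ?thesis
    proof (cases "j - i < m")
      case True
      thus ?thesis using that c cos_root_of_unity_le[of "j - i" m] by simp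
    next
      case False
      have "2 * pi * real (j - i) / m = 2 * pi * real (j - i - m) / m + 2 * pi"
        using False m by (simp add: of_nat_diff field_simps)
      hence "?c i j = cos (2 * pi * real (j - i - m) / m)" using c by simp
      thus ?thesis using False that cos_root_of_unity_le[of "j - i - m" m] by simp
    qed
  qed
  have main: "?c i j + ?c j k + ?c i k \<le> 1 + 2 * cos (2 * pi / m)"
    if "i < j" "j < k" "k < 2 * m" for i j k
  proof -
    have "?c i j \<le> 1" "?c j k \<le> 1" "?c i k \<le> 1" "cos (2 * pi / m) \<le> 1" by simp_all
    moreover have "j \<noteq> i + m \<or> k \<noteq> j + m" "j \<noteq> i + m \<or> k \<noteq> i + m" "k \<noteq> j + m \<or> k \<noteq> i + m"
      using that by auto
    ultimately show ?thesis using le[of i j] le[of j k] le[of i k] that by linarith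
  qed
  have "\<exists>i j k. S = {i, j, k} \<and> i < j \<and> j < k"
  proof -
    obtain a b c where "S = {a, b, c}" "a \<noteq> b" "b \<noteq> c" "a \<noteq> c"
      using S(2) by (auto simp: card_3_iff)
    thus ?thesis by (metis insert_commute linorder_neqE_nat)
  qed
  then obtain i j k where ijk: "S = {i, j, k}" "i < j" "j < k" by blast
  have "(\<Sum>j\<in>S. cis (2 * pi * real j / m))
      = cis (2 * pi * real k / m) + cis (2 * pi * real j / m) + cis (2 * pi * real i / m)"
    using ijk by (simp add: add_ac)
  hence "(norm (\<Sum>j\<in>S. cis (2 * pi * real j / m)))\<^sup>2 = 3 + 2 * (?c j k + ?c i j + ?c i k)"
    by (simp only: norm_sum_cis_3)
  thus ?thesis using main[of i j k] ijk S by simp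
qed

section \<open>Comparison of the maxima and the two choices of angles\<close>

text \<open>Only the doubled angles enter the condition numbers, so the hypothesis on
  \<open>\<theta>\<close> concerns these alone and covers both choices of angles.\<close>

lemma angle_matrix_optimal:
  assumes "N \<ge> 3" and "even N" and B: "B \<in> carrier_mat 2 N"
    and unit: "\<And>j. j < N \<Longrightarrow> vec_l2_norm (col B j) = 1"
    and \<theta>: "\<And>j. j < N \<Longrightarrow> cis (2 * \<theta> (Suc j)) = cis (2 * pi * real j / (N div 2))"
  shows "max_cond_number 3 (angle_matrix N \<theta>) \<le> max_cond_number 3 B"
proof -
  define m where "m = N div 2"
  have N: "N = 2 * m" and m: "m \<ge> 2" using assms(1,2) by (auto simp: m_def)
  let ?A = "angle_matrix N \<theta>"
  define F where "F R = (if R = 3 then \<infinity> else ereal (sqrt ((3 + R) / 2) / sqrt ((3 - R) / 2)))"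
    for R :: real
  have F_mono: "F R \<le> F R'" if "0 \<le> R" "R \<le> R'" "R' \<le> 3" for R R'
    using that by (auto simp: F_def intro!: frac_le)
  define zB where "zB j = (Complex (B $$ (0,j)) (B $$ (1,j)))\<^sup>2" for j
  have uB: "(B $$ (0,j))\<^sup>2 + (B $$ (1,j))\<^sup>2 = 1" if "j < N" for j
  proof -
    have "col B j \<bullet> col B j = (B $$ (0,j))\<^sup>2 + (B $$ (1,j))\<^sup>2"
      using B that by (simp add: scalar_prod_def numeral_2_eq_2 power2_eq_square)
    thus ?thesis using unit[OF that] by (simp add: vec_l2_norm_def)
  qed
  have nB: "norm (zB j) = 1" if "j < N" for j
    using uB[OF that] by (simp add: zB_def norm_power cmod_power2)
  have A: "?A \<in> carrier_mat 2 N" by (simp add: angle_matrix_def)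
  have zA: "(Complex (?A $$ (0,j)) (?A $$ (1,j)))\<^sup>2 = cis (2 * pi * real j / m)" if "j < N" for j
  proof -
    have "Complex (?A $$ (0,j)) (?A $$ (1,j)) = cis (\<theta> (Suc j))"
      using that by (simp add: angle_matrix_def complex_eq_iff)
    thus ?thesis using \<theta>[OF that] by (simp add: DeMoivre m_def)
  qed
  have condA: "cond_number (submatrix ?A UNIV S) = F (norm (\<Sum>j\<in>S. cis (2 * pi * real j / m)))"
    if S: "S \<subseteq> {0..<N}" "card S = 3" for S
  proof -
    have "(\<Sum>j\<in>S. (Complex (?A $$ (0,j)) (?A $$ (1,j)))\<^sup>2) = (\<Sum>j\<in>S. cis (2 * pi * real j / m))"
      using S by (intro sum.cong zA) auto
    moreover have "(?A $$ (0,j))\<^sup>2 + (?A $$ (1,j))\<^sup>2 = 1" if "j \<in> S" for j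
      using that S by (auto simp: angle_matrix_def)
    ultimately show ?thesis using cond_number_unit_columns[OF A S] by (simp add: F_def)
  qed
  have condB: "cond_number (submatrix B UNIV S) = F (norm (\<Sum>j\<in>S. zB j))"
    if S: "S \<subseteq> {0..<N}" "card S = 3" for S
  proof -
    have "(B $$ (0,j))\<^sup>2 + (B $$ (1,j))\<^sup>2 = 1" if "j \<in> S" for j
      using that uB S by auto
    from cond_number_unit_columns[OF B S this] show ?thesis by (simp only: F_def zB_def)
  qed
  obtain T where T: "T \<subseteq> {0..<N}" "card T = 3"
    and large: "(norm (\<Sum>j\<in>T. zB j))\<^sup>2 \<ge> 5 + 4 * cos (2 * pi / m)"
    using exists_large_triple[OF m, of zB] nB unfolding N by blast
  \<comment> \<open>\<open>F\<close> is monotone only up to 3; beyond, its denominator is the root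
    of a negative number, which is negative here.\<close>
  have "norm (\<Sum>j\<in>T. zB j) \<le> (\<Sum>j\<in>T. 1)"
    using T nB by (intro sum_norm_le) auto
  hence T3: "norm (\<Sum>j\<in>T. zB j) \<le> 3" using T by simp
  let ?I = "{S. S \<subseteq> {0..<N} \<and> card S = 3}"
  have fin: "finite ?I" by simp
  have "cond_number (submatrix ?A UNIV S) \<le> cond_number (submatrix B UNIV T)" if "S \<in> ?I" for S
  proof -
    have "(norm (\<Sum>j\<in>S. cis (2 * pi * real j / m)))\<^sup>2 \<le> (norm (\<Sum>j\<in>T. zB j))\<^sup>2"
      using that N by (intro order_trans[OF doubled_polygon_triple_le[OF m] large]) auto
    hence "norm (\<Sum>j\<in>S. cis (2 * pi * real j / m)) \<le> norm (\<Sum>j\<in>T. zB j)"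
      by (rule power2_le_imp_le) simp
    thus ?thesis using condA condB T that T3 by (simp add: F_mono)
  qed
  moreover have "cond_number (submatrix B UNIV T) \<le> max_cond_number 3 B"
    unfolding max_cond_number_def using B T by (intro Max_ge) auto
  ultimately have "\<forall>x\<in>(\<lambda>S. cond_number (submatrix ?A UNIV S)) ` ?I. x \<le> max_cond_number 3 B"
    using order_trans by blast
  moreover have "?I \<noteq> {}" using T by blast
  ultimately show ?thesis
    unfolding max_cond_number_def[of 3 ?A] using A fin by (subst Max_le_iff) auto
qed

theorem theorem4p1:
  fixes N :: nat and B :: "real mat"
  assumes "N \<ge> 3" and "even N"
    and "B \<in> carrier_mat 2 N"
    and "\<And>j. j < N \<Longrightarrow> vec_l2_norm (col B j) = 1"
  shows "max_cond_number 3 (angle_matrix N (\<lambda>i. (2 * pi * (real i - 1) / real N) rmod pi))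
           \<le> max_cond_number 3 B
       \<and> max_cond_number 3 (angle_matrix N (\<lambda>i. 2 * pi * (real i - 1) / real N))
           \<le> max_cond_number 3 B"
proof
  have "N = 2 * (N div 2)" using assms(2) by simp
  hence "real N = 2 * real (N div 2)" by linarith
  hence half: "2 * (2 * pi * (real (Suc j) - 1) / real N) = 2 * pi * real j / (N div 2)" for j
    by simp
  \<comment> \<open>Reduction modulo \<open>pi\<close> subtracts a multiple of \<open>pi\<close>,
    which doubling turns into full turns.\<close>
  have rmod: "cis (2 * (x rmod pi)) = cis (2 * x)" for x
  proof -
    have "2 * (x rmod pi) = 2 * x - 2 * pi * of_int \<lfloor>x / pi\<rfloor>"
      by (simp add: rmod_def algebra_simps)
    hence "cis (2 * (x rmod pi)) = cis (2 * x) / cis (2 * pi * of_int \<lfloor>x / pi\<rfloor>)"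
      by (simp only: cis_divide)
    thus ?thesis by (simp add: cis_multiple_2pi)
  qed
  show "max_cond_number 3 (angle_matrix N (\<lambda>i. (2 * pi * (real i - 1) / real N) rmod pi))
      \<le> max_cond_number 3 B"
    by (rule angle_matrix_optimal[OF assms]) (simp_all only: rmod half)
  show "max_cond_number 3 (angle_matrix N (\<lambda>i. 2 * pi * (real i - 1) / real N))
      \<le> max_cond_number 3 B"
    by (rule angle_matrix_optimal[OF assms]) (simp_all only: half)
qed

end
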